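(* Let $K$ be a finite Eulerian poset with minimum $\hat 0$ and rank function $\rho$, and let $P\in\mathrm{Or}(K)$ be a special projection. Then the induced subposet $(K\setminus \mathrm{Im}(P))\cup\{\hat 0\}$ of $K$ is graded with rank function (the restriction of) $\rho$.
   Context: A finite poset $K$ is graded if it has a minimum $\hat 0$, a maximum $\hat 1$ and a rank function $\rho:K\to\mathbb N$ ($\rho(y)=\rho(x)+1$ whenever $y$ covers $x$, written $x\vartriangleleft y$); it is Eulerian if moreover $\mu_K(x,y)=(-1)^{\rho(y)-\rho(x)}$ for all $x\leqslant y$. $\mathrm{Or}(K)$ is the monoid under composition of order preserving regressive ($f(x)\leqslant x$) maps $K\to K$. A matching of $K$ is a map $M:K\to K$ with $M\circ M=\mathrm{id}_K$ and, for all $x$, $M(x)\vartriangleleft x$ or $x\vartriangleleft M(x)$; it is special if $x\vartriangleleft y$ and $x\neq M(y)$ imply $M(x)\leqslant M(y)$. For a special matching $M$, $P^M:K\to K$ is $P^M(x)=x$ if $x\vartriangleleft M(x)$ and $P^M(x)=M(x)$ if $M(x)\vartriangleleft x$. $M^K$ is the submonoid of $\mathrm{Or}(K)$ generated by $\mathrm{id}_K$ and all $P^M$, $M$ a special matching of $K$. For $f:K\to K$, $f_y:=\{x:f(x)=y\}$. An idempotent $P\in\mathrm{Or}(K)$ is a projection if for all $x,y\in\mathrm{Im}(P)$ with $x\leqslant y$ the set $[x,y]\cap P_x$ is an interval of $K$. A special projection is a projection belonging to $M^K$. *)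

theory Defs
  imports Main "HOL-Library.FuncSet"
begin

text \<open>
  A finite poset is given by a finite subset \<open>K\<close> of a partially ordered type; the subposet of \<open>K\<close>
  induced on \<open>S \<subseteq> K\<close> is then \<open>S\<close> itself. All notions below (covering, intervals, Moebius function)
  are relative to the carrier. Maps \<open>K \<rightarrow> K\<close> are the extensional functions \<open>K \<rightarrow>\<^sub>E K\<close>, so that equality
  of maps is equality in HOL; their composition is \<open>compose K\<close>.
\<close>

definition covers_in :: "'a::order set \<Rightarrow> 'a \<Rightarrow> 'a \<Rightarrow> bool" where
  "covers_in K x y \<longleftrightarrow> x \<in> K \<and> y \<in> K \<and> x < y \<and> \<not> (\<exists>z\<in>K. x < z \<and> z < y)"

definition is_minimum :: "'a::order set \<Rightarrow> 'a \<Rightarrow> bool" where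
  "is_minimum K b \<longleftrightarrow> b \<in> K \<and> (\<forall>x\<in>K. b \<le> x)"

definition is_maximum :: "'a::order set \<Rightarrow> 'a \<Rightarrow> bool" where
  "is_maximum K t \<longleftrightarrow> t \<in> K \<and> (\<forall>x\<in>K. x \<le> t)"

text \<open>The rank function is not normalised: its value at the minimum is arbitrary.\<close>

definition graded_poset :: "'a::order set \<Rightarrow> ('a \<Rightarrow> nat) \<Rightarrow> bool" where
  "graded_poset K \<rho> \<longleftrightarrow>
     finite K \<and> (\<exists>b. is_minimum K b) \<and> (\<exists>t. is_maximum K t) \<and>
     (\<forall>x y. covers_in K x y \<longrightarrow> \<rho> y = \<rho> x + 1)"

function moebius :: "'a::order set \<Rightarrow> 'a \<Rightarrow> 'a \<Rightarrow> int" where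
  "moebius K x y =
     (if finite K \<and> x \<in> K \<and> y \<in> K \<and> x \<le> y then
        if x = y then 1 else - (\<Sum>z\<in>{z \<in> K. x \<le> z \<and> z < y}. moebius K x z)
      else 0)"
  by pat_completeness auto
termination
proof (relation "measure (\<lambda>(K, x, y). card {w \<in> K. w < y})", goal_cases)
  case 1
  show ?case by simp
next
  case (2 K x y z)
  then have "{w \<in> K. w < z} \<subset> {w \<in> K. w < y}" by auto
  with 2 show ?case by (auto intro!: psubset_card_mono)
qed

declare moebius.simps [simp del]

text \<open>
  Truncated subtraction is harmless in the exponent: \<open>x \<le> y\<close> implies \<open>\<rho> x \<le> \<rho> y\<close> in a graded poset.
\<close>

definition eulerian_poset :: "'a::order set \<Rightarrow> ('a \<Rightarrow> nat) \<Rightarrow> bool" where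
  "eulerian_poset K \<rho> \<longleftrightarrow>
     graded_poset K \<rho> \<and>
     (\<forall>x\<in>K. \<forall>y\<in>K. x \<le> y \<longrightarrow> moebius K x y = (- 1) ^ (\<rho> y - \<rho> x))"

definition Or :: "'a::order set \<Rightarrow> ('a \<Rightarrow> 'a) set" where
  "Or K = {f \<in> K \<rightarrow>\<^sub>E K. mono_on K f \<and> (\<forall>x\<in>K. f x \<le> x)}"

definition matching :: "'a::order set \<Rightarrow> ('a \<Rightarrow> 'a) \<Rightarrow> bool" where
  "matching K M \<longleftrightarrow>
     M \<in> K \<rightarrow>\<^sub>E K \<and> compose K M M = restrict id K \<and>
     (\<forall>x\<in>K. covers_in K (M x) x \<or> covers_in K x (M x))"

definition special_matching :: "'a::order set \<Rightarrow> ('a \<Rightarrow> 'a) \<Rightarrow> bool" where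
  "special_matching K M \<longleftrightarrow>
     matching K M \<and> (\<forall>x y. covers_in K x y \<and> x \<noteq> M y \<longrightarrow> M x \<le> M y)"

definition matching_map :: "'a::order set \<Rightarrow> ('a \<Rightarrow> 'a) \<Rightarrow> 'a \<Rightarrow> 'a" where
  "matching_map K M = (\<lambda>x\<in>K. if covers_in K x (M x) then x else M x)"

inductive_set matching_monoid :: "'a::order set \<Rightarrow> ('a \<Rightarrow> 'a) set" for K where
  id: "restrict id K \<in> matching_monoid K"
| gen: "special_matching K M \<Longrightarrow> matching_map K M \<in> matching_monoid K"
| comp: "f \<in> matching_monoid K \<Longrightarrow> g \<in> matching_monoid K \<Longrightarrow> compose K f g \<in> matching_monoid K"

definition fiber :: "'a set \<Rightarrow> ('a \<Rightarrow> 'a) \<Rightarrow> 'a \<Rightarrow> 'a set" where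
  "fiber K f y = {x \<in> K. f x = y}"

definition interval_in :: "'a::order set \<Rightarrow> 'a \<Rightarrow> 'a \<Rightarrow> 'a set" where
  "interval_in K x y = {z \<in> K. x \<le> z \<and> z \<le> y}"

definition projection :: "'a::order set \<Rightarrow> ('a \<Rightarrow> 'a) \<Rightarrow> bool" where
  "projection K P \<longleftrightarrow>
     P \<in> Or K \<and> compose K P P = P \<and>
     (\<forall>x\<in>P ` K. \<forall>y\<in>P ` K. x \<le> y \<longrightarrow>
        (\<exists>a\<in>K. \<exists>b\<in>K. a \<le> b \<and> interval_in K x y \<inter> fiber K P x = interval_in K a b))"

definition special_projection :: "'a::order set \<Rightarrow> ('a \<Rightarrow> 'a) \<Rightarrow> bool" where
  "special_projection K P \<longleftrightarrow> projection K P \<and> P \<in> matching_monoid K"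

end

theory Submission
  imports Defs
begin

text \<open>
  Let \<open>y\<close> cover \<open>x\<close> in the subposet but not in \<open>K\<close>. Then all elements strictly between \<open>x\<close> and
  \<open>y\<close> are fixed by \<open>P\<close>, hence they lie below \<open>P y < y\<close>. So \<open>P y\<close> is the only coatom of \<open>[x, y]\<close>,
  which forces \<open>\<mu>(x, y) = 0\<close>, impossible in an Eulerian poset. A maximum exists because every
  special matching moves the top of \<open>K\<close> down, so that only the identity fixes it.
\<close>

text \<open>In the recursion for \<open>y\<close> the sum runs over \<open>c\<close> and the
  elements of [x, c); by the recursion at \<open>c\<close> these two contributions cancel.\<close>

lemma moebius_unique_coatom:
  assumes "finite K" "x \<in> K" "c \<in> K" "y \<in> K" "x < c" "c < y"
    and below: "\<And>z. z \<in> K \<Longrightarrow> x < z \<Longrightarrow> z < y \<Longrightarrow> z \<le> c"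
  shows "moebius K x y = 0"
proof -
  let ?S = "{z \<in> K. x \<le> z \<and> z < c}"
  have "{z \<in> K. x \<le> z \<and> z < y} = insert c ?S"
    using assms by (auto simp: order.order_iff_strict)
  moreover have "moebius K x c = - (\<Sum>z\<in>?S. moebius K x z)"
    using assms by (subst moebius.simps) auto
  ultimately show ?thesis
    using assms by (subst moebius.simps) auto
qed

text \<open>Regressiveness is carried through the induction because it decides the composition case:
  once \<open>g\<close> lowers \<open>t\<close>, \<open>f\<close> cannot raise it back.\<close>

lemma matching_monoid_moves_maximum:
  assumes "f \<in> matching_monoid K" and t: "is_maximum K t"
  shows "f \<in> K \<rightarrow> K \<and> (\<forall>x\<in>K. f x \<le> x) \<and> ((\<forall>x\<in>K. f x = x) \<or> f t \<noteq> t)"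
  using assms(1)
proof induction
  case id
  then show ?case by simp
next
  case (gen M)
  have M: "M \<in> K \<rightarrow> K" and cov: "\<And>x. x \<in> K \<Longrightarrow> covers_in K (M x) x \<or> covers_in K x (M x)"
    using gen by (auto simp: special_matching_def matching_def)
  \<comment> \<open>Nothing covers the top, so \<open>matching_map K M\<close> sends
    \<open>t\<close> to \<open>M t\<close>, which differs from \<open>t\<close>.\<close>
  have "t \<in> K" and "\<not> covers_in K t (M t)"
    using t by (auto simp: is_maximum_def covers_in_def less_le_not_le)
  moreover from this have "M t \<noteq> t"
    using cov[of t] by (auto simp: covers_in_def)
  moreover have "M x \<le> x" if "x \<in> K" "\<not> covers_in K x (M x)" for x
    using cov[of x] that by (auto simp: covers_in_def)
  ultimately show ?case
    using M by (auto simp: matching_map_def)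
next
  case (comp f g)
  have tK: "t \<in> K" using t by (simp add: is_maximum_def)
  have "f (g x) \<le> x" if "x \<in> K" for x
    using comp.IH that by (meson Pi_mem order.trans)
  moreover have "(\<forall>x\<in>K. f (g x) = x) \<or> f (g t) \<noteq> t"
  proof (cases "\<forall>x\<in>K. g x = x")
    case True
    then show ?thesis using comp.IH tK by auto
  next
    case False
    then have "g t \<in> K" "g t < t" "f (g t) \<le> g t"
      using comp.IH tK by (auto simp: Pi_iff order.strict_iff_order)
    then show ?thesis by auto
  qed
  ultimately show ?case
    using comp.IH tK by (auto simp: compose_def)
qed

theorem theorem4p12:
  fixes K :: "'a::order set" and \<rho> :: "'a \<Rightarrow> nat" and P :: "'a \<Rightarrow> 'a" and b :: 'a
  assumes "eulerian_poset K \<rho>"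
    and "is_minimum K b"
    and "special_projection K P"
  shows "graded_poset ((K - P ` K) \<union> {b}) \<rho>"
proof -
  let ?Q = "(K - P ` K) \<union> {b}"
  have fin: "finite K"
    and cov: "\<And>x y. covers_in K x y \<Longrightarrow> \<rho> y = \<rho> x + 1"
    and mu: "\<And>x y. x \<in> K \<Longrightarrow> y \<in> K \<Longrightarrow> x \<le> y \<Longrightarrow> moebius K x y = (- 1) ^ (\<rho> y - \<rho> x)"
    using assms(1) by (auto simp: eulerian_poset_def graded_poset_def)
  obtain t where t: "is_maximum K t"
    using assms(1) by (auto simp: eulerian_poset_def graded_poset_def)
  have b: "b \<in> K" "\<And>x. x \<in> K \<Longrightarrow> b \<le> x"
    using assms(2) by (auto simp: is_minimum_def)
  have PK: "\<And>x. x \<in> K \<Longrightarrow> P x \<in> K" and reg: "\<And>x. x \<in> K \<Longrightarrow> P x \<le> x"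
    and mono: "mono_on K P" and idem: "compose K P P = P" and gen: "P \<in> matching_monoid K"
    using assms(3) by (auto simp: special_projection_def projection_def Or_def)
  have fixed: "P z = z" if "z \<in> P ` K" for z
  proof -
    from that obtain x where x: "x \<in> K" "z = P x" by blast
    have "P (P x) = compose K P P x" using x(1) by (simp only: compose_eq)
    then show ?thesis unfolding idem x(2) .
  qed
  have QK: "?Q \<subseteq> K" using b by auto
  have "is_minimum ?Q b"
    using b by (auto simp: is_minimum_def)
  moreover have "\<exists>m. is_maximum ?Q m"
  proof (cases "\<forall>x\<in>K. P x = x")
    case True
    \<comment> \<open>The image is all of \<open>K\<close>, so \<open>b\<close> alone remains and is
      also the maximum.\<close>
    then have "?Q = {b}" by auto
    then show ?thesis by (auto simp: is_maximum_def)
  next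
    case False
    then have "P t \<noteq> t" using matching_monoid_moves_maximum[OF gen t] by blast
    \<comment> \<open>Elements of the image are fixed, so the moved element \<open>t\<close> lies
      outside it.\<close>
    then have "t \<in> ?Q" using fixed[of t] t by (auto simp only: is_maximum_def)
    then have "is_maximum ?Q t" using t QK by (auto simp: is_maximum_def)
    then show ?thesis ..
  qed
  moreover have "\<rho> y = \<rho> x + 1" if xy: "covers_in ?Q x y" for x y
  proof (rule ccontr)
    assume "\<rho> y \<noteq> \<rho> x + 1"
    then have "\<not> covers_in K x y" using cov by blast
    moreover have xK: "x \<in> K" and yK: "y \<in> K" and less: "x < y"
      using xy QK by (auto simp: covers_in_def)
    ultimately obtain z where z: "z \<in> K" "x < z" "z < y"
      by (auto simp: covers_in_def)
    \<comment> \<open>Since b \<le> x < y, \<open>y\<close> is not \<open>b\<close>, so it belongs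
      to \<open>?Q\<close> as a non-image.\<close>
    have "y \<notin> P ` K"
      using xy b(2)[OF xK] less by (auto simp: covers_in_def)
    then have "P y \<noteq> y" using imageI[OF yK, of P] by metis
    then have Py: "P y < y" using reg[OF yK] by simp
    have below: "w \<le> P y" if "w \<in> K" "x < w" "w < y" for w
    proof -
      \<comment> \<open>Otherwise \<open>w\<close> would be an element of \<open>?Q\<close> strictly
        between \<open>x\<close> and \<open>y\<close>.\<close>
      have "w \<in> P ` K" using that xy unfolding covers_in_def by blast
      then have "P w = w" by (rule fixed)
      moreover have "P w \<le> P y" using mono_onD[OF mono \<open>w \<in> K\<close> yK] that by simp
      ultimately show ?thesis by simp
    qed
    \<comment> \<open>Here the failure of the covering in \<open>K\<close> enters: x < z \<le> P
      y.\<close>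
    have "x < P y" using below[OF z] z by simp
    then have "moebius K x y = 0"
      using moebius_unique_coatom[OF fin xK PK[OF yK] yK _ Py below] by simp
    \<comment> \<open>A power of -1 is never zero.\<close>
    then show False using mu[OF xK yK] less by simp
  qed
  ultimately show ?thesis
    using finite_subset[OF QK fin] unfolding graded_poset_def by blast
qed

end
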